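(* Assume a multiplier whose input multiplicands $A$ and $B$ are constructed from an $N$-element sequence $f$ and a $K$-element sequence $g$, where $f$ and $g$ are quantized to $p$ and $q$ bits, respectively, by $$A=\sum_{n=0}^{N-1} f[n]\,2^{S n},\qquad B=\sum_{k=0}^{K-1} g[k]\,2^{S k},$$ with slices of size $S$ that include guard bits $G_b$. Then one can obtain from the product $Prod=A\times B$ a total of $N+K-1$ segments, all of which are short partial convolutions in the form of 1-D convolution, that is, of the form $$y[m]=\sum_{n+k=m} f[n]\,g[k],\qquad 0\le m\le N+K-2 .$$
   Context: The multiplier multiplies an $L_A$-bit integer input $A$ with an $L_B$-bit integer input $B$ and returns the product $Prod=A\times B$. The sequences $f=(f[0],\dots,f[N-1])$ and $g=(g[0],\dots,g[K-1])$ consist of low-bitwidth integers ($p$-bit and $q$-bit, respectively). $N$ and $K$ are assumed to be the maximum numbers of elements of $f$ and $g$ that fit into $A$ and $B$. A slice is a block of $S$ consecutive bits of an input, whose lower bits hold one element of $f$ or $g$. Each slice must be large enough to hold both the bits of a product of a $p$-bit and a $q$-bit input and $G_b$ additional guard bits. The guard bits are extra bits whose number depends on the maximum number of terms $f[n]\cdot g[k]$ that are summed together in one output segment (at most $\min(K,N)$ for a single multiplier); they serve to prevent overlap between adjacent intermediate results and to allow the accumulated partial products to be separated. A segment of $Prod$ is the part of $Prod$ associated with the weight $2^{S m}$ (an $S$-bit block), for $0\le m\le N+K-2$. In the 1-D discrete convolution of $f$ and $g$, the sum over $n+k=m$ ranges over $0\le n<N$, $0\le k<K$, and each $y[m]$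 is called a partial convolution. *)

theory Defs
  imports "HOL-Library.Log_Nat"
begin

datatype number_format = Unsigned | Twos_Complement

text \<open>For \<open>w \<ge> 1\<close> the second equation is the usual range
  \<open>- 2 ^ (w - 1) \<le> x < 2 ^ (w - 1)\<close>; doubling avoids the truncated \<open>w - 1\<close> at \<open>w = 0\<close>.\<close>
fun is_bits :: "number_format \<Rightarrow> nat \<Rightarrow> int \<Rightarrow> bool" where
  "is_bits Unsigned w x \<longleftrightarrow> 0 \<le> x \<and> x < 2 ^ w"
| "is_bits Twos_Complement w x \<longleftrightarrow> - (2 ^ w) \<le> 2 * x \<and> 2 * x < 2 ^ w"

definition pack :: "nat \<Rightarrow> nat \<Rightarrow> (nat \<Rightarrow> int) \<Rightarrow> int" where
  "pack S N f = (\<Sum>n<N. f n * 2 ^ (S * n))"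

text \<open>Element \<open>i\<close> occupies the bits \<open>S * i, \<dots>, S * i + w - 1\<close>, the lower bits of slice \<open>i\<close>,
  so the last slice of an \<open>L\<close>-bit input need not be complete.\<close>
definition fits :: "nat \<Rightarrow> nat \<Rightarrow> nat \<Rightarrow> nat \<Rightarrow> bool" where
  "fits L S w n \<longleftrightarrow> (\<forall>i<n. S * i + w \<le> L)"

definition max_fit :: "nat \<Rightarrow> nat \<Rightarrow> nat \<Rightarrow> nat \<Rightarrow> bool" where
  "max_fit L S w N \<longleftrightarrow> fits L S w N \<and> (\<forall>n. fits L S w n \<longrightarrow> n \<le> N)"

definition holds_product :: "number_format \<Rightarrow> nat \<Rightarrow> nat \<Rightarrow> nat \<Rightarrow> bool" where
  "holds_product fmt p q w \<longleftrightarrow>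
     (\<forall>a b. is_bits fmt p a \<longrightarrow> is_bits fmt q b \<longrightarrow> is_bits fmt w (a * b))"

text \<open>\<open>ceillog2 t\<close> extra bits suffice for a sum of \<open>t\<close> terms; an output segment sums at most
  \<open>min K N\<close> products.\<close>
definition valid_slice ::
    "number_format \<Rightarrow> nat \<Rightarrow> nat \<Rightarrow> nat \<Rightarrow> nat \<Rightarrow> nat \<Rightarrow> nat \<Rightarrow> bool" where
  "valid_slice fmt p q N K Gb S \<longleftrightarrow>
     ceillog2 (min K N) \<le> Gb \<and> (\<exists>w. holds_product fmt p q w \<and> w + Gb \<le> S)"

text \<open>The segment of weight \<open>2 ^ (S * m)\<close> is read off the bits \<open>S * m, \<dots>, S * m + S - 1\<close>.
  In two's complement a negative lower part borrows one unit from this block; the sign of the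
  lower part is visible in the bit just below the block, and adding that bit undoes the borrow.\<close>
fun segment :: "number_format \<Rightarrow> nat \<Rightarrow> int \<Rightarrow> nat \<Rightarrow> int" where
  "segment Unsigned S P m = take_bit S (drop_bit (S * m) P)"
| "segment Twos_Complement S P m =
     signed_take_bit (S - 1) (drop_bit (S * m) P) + of_bool (0 < m \<and> bit P (S * m - 1))"

definition conv :: "nat \<Rightarrow> nat \<Rightarrow> (nat \<Rightarrow> int) \<Rightarrow> (nat \<Rightarrow> int) \<Rightarrow> nat \<Rightarrow> int" where
  "conv N K f g m = (\<Sum>(n, k) | n < N \<and> k < K \<and> n + k = m. f n * g k)"

end

theory Submission
  imports Defs
begin

text \<open>Multiplying out gives \<open>Prod = (\<Sum>m. conv m * 2 ^ (S * m))\<close>, so the claim is that the digits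
  \<open>conv m\<close> in base \<open>2 ^ S\<close> can be read off. Unsigned digits lie in \<open>{0..<2 ^ S}\<close> and are the
  usual ones. In two's complement the range \<open>{-2 ^ (S - 1)..<2 ^ (S - 1)}\<close> alone would not
  suffice (with \<open>S = 2\<close> and two lower digits equal to \<open>-2\<close>, the bit below the block is not the
  sign of the lower part \<open>-10\<close>). But a slice that holds the product of the two most negative
  elements has \<open>w \<ge> p + q\<close>, so in fact \<open>\<bar>conv m\<bar> \<le> 2 ^ (S - 2)\<close>. This keeps the lower part below
  \<open>2 ^ (S * m - 1)\<close> in absolute value and leaves room for the borrow.\<close>

section \<open>Reading digits off a sum in base \<open>2 ^ S\<close>\<close>

lemma digit_sum_split:
  fixes y :: "nat \<Rightarrow> int"
  assumes "m \<le> M"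
  shows "\<exists>X. (\<Sum>j\<le>M. y j * 2 ^ (S * j)) = 2 ^ (S * m) * (y m + 2 ^ S * X) + (\<Sum>j<m. y j * 2 ^ (S * j))"
  using assms
proof (induction M rule: dec_induct)
  case base
  show ?case
    by (rule exI[of _ 0]) (simp add: lessThan_Suc_atMost[symmetric])
next
  case (step M)
  then obtain X where X: "(\<Sum>j\<le>M. y j * 2 ^ (S * j))
      = 2 ^ (S * m) * (y m + 2 ^ S * X) + (\<Sum>j<m. y j * 2 ^ (S * j))" by blast
  \<comment> \<open>The new digit lies above position \<open>m\<close>, so its weight is a multiple
    of \<open>2 ^ (S * m) * 2 ^ S\<close> and it is absorbed into \<open>X\<close>, which collects
    all digits above \<open>m\<close>.\<close>
  have "S * Suc M = S * m + S + S * (M - m)"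
    using step(1) by (metis add.assoc add.commute add_diff_inverse_nat distrib_left linorder_not_less mult_Suc_right)
  hence "(2::int) ^ (S * Suc M) = 2 ^ (S * m) * 2 ^ S * 2 ^ (S * (M - m))"
    by (simp add: power_add)
  thus ?case
    unfolding sum.atMost_Suc X
    by (intro exI[of _ "X + y (Suc M) * 2 ^ (S * (M - m))"]) (simp only: algebra_simps)
qed

lemma low_digits_unsigned:
  fixes y :: "nat \<Rightarrow> int"
  assumes "\<And>j. j < m \<Longrightarrow> 0 \<le> y j \<and> y j < 2 ^ S"
  shows "0 \<le> (\<Sum>j<m. y j * 2 ^ (S * j)) \<and> (\<Sum>j<m. y j * 2 ^ (S * j)) < 2 ^ (S * m)"
  using assms
proof (induction m)
  case (Suc m)
  have "y m + 1 \<le> 2 ^ S" using Suc.prems[of m] by simp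
  hence "(y m + 1) * 2 ^ (S * m) \<le> 2 ^ S * (2::int) ^ (S * m)"
    by (intro mult_right_mono) auto
  moreover have "0 \<le> y m * 2 ^ (S * m)" using Suc.prems[of m] by simp
  ultimately show ?case using Suc.IH Suc.prems by (simp add: power_add algebra_simps)
qed simp

text \<open>The factor 2 on the left leaves one spare bit: the lower part stays within half the
  weight of the block, so that the bit just below the block shows its sign.\<close>

lemma low_digits_signed:
  fixes y :: "nat \<Rightarrow> int"
  assumes "2 \<le> S" and "\<And>j. j < m \<Longrightarrow> 4 * \<bar>y j\<bar> \<le> 2 ^ S"
  shows "2 * \<bar>\<Sum>j<m. y j * 2 ^ (S * j)\<bar> < 2 ^ (S * m)"
  using assms(2)
proof (induction m)
  case (Suc m)
  let ?L = "\<Sum>j<m. y j * 2 ^ (S * j)"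
  \<comment> \<open>The aim is one spare unit next to \<open>2 * \<bar>y m\<bar>\<close>: in
    multiples of \<open>2 ^ (S * m)\<close> it pays for the strict bound on the lower
    digits.\<close>
  have "(2::int) ^ 2 \<le> 2 ^ S" using assms(1) by (intro power_increasing) auto
  hence "2 + 4 * \<bar>y m\<bar> \<le> 2 * 2 ^ S" using Suc.prems[of m] by simp
  hence "1 + 2 * \<bar>y m\<bar> \<le> 2 ^ S" by linarith
  hence "(1 + 2 * \<bar>y m\<bar>) * 2 ^ (S * m) \<le> 2 ^ S * (2::int) ^ (S * m)"
    by (intro mult_right_mono) auto
  moreover have "\<bar>?L + y m * 2 ^ (S * m)\<bar> \<le> \<bar>?L\<bar> + \<bar>y m\<bar> * 2 ^ (S * m)"
    using abs_triangle_ineq[of ?L "y m * 2 ^ (S * m)"] by (simp add: abs_mult)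
  moreover have "2 * \<bar>?L\<bar> < 2 ^ (S * m)" using Suc by simp
  ultimately show ?case by (simp add: power_add algebra_simps)
qed simp

lemma segment_Unsigned_digit_sum:
  fixes y :: "nat \<Rightarrow> int"
  assumes "\<And>j. j \<le> M \<Longrightarrow> 0 \<le> y j \<and> y j < 2 ^ S" and "m \<le> M"
  shows "segment Unsigned S (\<Sum>j\<le>M. y j * 2 ^ (S * j)) m = y m"
proof -
  obtain X where X: "(\<Sum>j\<le>M. y j * 2 ^ (S * j))
      = 2 ^ (S * m) * (y m + 2 ^ S * X) + (\<Sum>j<m. y j * 2 ^ (S * j))"
    using digit_sum_split[OF assms(2)] by blast
  have "0 \<le> (\<Sum>j<m. y j * 2 ^ (S * j)) \<and> (\<Sum>j<m. y j * 2 ^ (S * j)) < 2 ^ (S * m)"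
    using assms by (intro low_digits_unsigned) auto
  hence "drop_bit (S * m) (\<Sum>j\<le>M. y j * 2 ^ (S * j)) = y m + 2 ^ S * X"
    unfolding X by (simp add: drop_bit_eq_div div_mult_self4)
  thus ?thesis using assms(1)[OF assms(2)] by (simp add: take_bit_eq_mod)
qed

lemma signed_take_bit_add_multiple:
  fixes x :: int
  assumes "0 < S" and "- (2 ^ (S - 1)) \<le> x" and "x < 2 ^ (S - 1)"
  shows "signed_take_bit (S - 1) (x + 2 ^ S * X) = x"
proof -
  \<comment> \<open>Only the low \<open>Suc (S - 1)\<close> bits matter, and these are
    \<open>S\<close> bits since \<open>0 < S\<close>.\<close>
  have "signed_take_bit (S - 1) (x + 2 ^ S * X) = signed_take_bit (S - 1) x"
    using assms(1) by (simp add: signed_take_bit_eq_iff_take_bit_eq take_bit_eq_mod)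
  also have "\<dots> = x" using assms by (intro signed_take_bit_int_eq_self) auto
  finally show ?thesis .
qed

text \<open>Division rounds down, so a negative \<open>x\<close> gives quotient -1. This is used at
  two scales: dividing by the weight of the block gives the borrow, dividing by half of it gives the
  bit below the block.\<close>

lemma div_eq_neg_of_bool:
  fixes x d :: int
  assumes "\<bar>x\<bar> < d"
  shows "x div d = - of_bool (x < 0)"
proof (cases "x < 0")
  case True
  thus ?thesis using assms by (intro int_div_pos_eq[of _ _ _ "x + d"]) auto
qed (use assms in simp)

lemma segment_Twos_Complement_digit_sum:
  fixes y :: "nat \<Rightarrow> int"
  assumes S: "2 \<le> S" and y: "\<And>j. j \<le> M \<Longrightarrow> 4 * \<bar>y j\<bar> \<le> 2 ^ S" and "m \<le> M"
  shows "segment Twos_Complement S (\<Sum>j\<le>M. y j * 2 ^ (S * j)) m = y m"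
proof -
  define P where "P = (\<Sum>j\<le>M. y j * 2 ^ (S * j))"
  define L where "L = (\<Sum>j<m. y j * 2 ^ (S * j))"
  obtain X where X: "P = 2 ^ (S * m) * (y m + 2 ^ S * X) + L"
    using digit_sum_split[OF assms(3)] unfolding P_def L_def by blast
  have L: "2 * \<bar>L\<bar> < 2 ^ (S * m)"
    unfolding L_def using assms by (intro low_digits_signed) auto
  have borrow: "L div 2 ^ (S * m) = - of_bool (L < 0)"
    using L by (intro div_eq_neg_of_bool) simp
  have drop: "drop_bit (S * m) P = (y m - of_bool (L < 0)) + 2 ^ S * X"
    unfolding X by (simp add: drop_bit_eq_div div_mult_self4 borrow)
  have below: "0 < m \<and> bit P (S * m - 1) \<longleftrightarrow> L < 0"
  proof (cases "m = 0")
    case True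
    thus ?thesis by (simp add: L_def)
  next
    case False
    hence pow: "(2::int) ^ (S * m) = 2 ^ (S * m - 1) * 2"
      using S by (simp flip: power_Suc2)
    have Lb: "\<bar>L\<bar> < 2 ^ (S * m - 1)" using L unfolding pow by simp
    \<comment> \<open>At half the weight the digits from \<open>m\<close> upwards contribute an even
      number, so the parity of the quotient depends on \<open>L\<close> alone.\<close>
    have "P = 2 ^ (S * m - 1) * (2 * (y m + 2 ^ S * X)) + L" unfolding X pow by simp
    hence "P div 2 ^ (S * m - 1) = 2 * (y m + 2 ^ S * X) + L div 2 ^ (S * m - 1)"
      by (simp add: div_mult_self4)
    moreover have "L div 2 ^ (S * m - 1) = - of_bool (L < 0)"
      using Lb by (rule div_eq_neg_of_bool)
    ultimately show ?thesis using False by (simp add: bit_iff_odd)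
  qed
  \<comment> \<open>These give \<open>\<bar>y m\<bar> \<le> 2 ^ (S - 1) / 2\<close> and
    \<open>1 \<le> 2 ^ (S - 1) / 2\<close>, so the digit minus the borrow stays in the signed
    range.\<close>
  have four: "(2::int) ^ S = 2 * 2 ^ (S - 1)" and two: "(2::int) \<le> 2 ^ (S - 1)"
    using S power_increasing[of 1 "S - 1" "2::int"] by (simp_all flip: power_Suc)
  have "signed_take_bit (S - 1) ((y m - of_bool (L < 0)) + 2 ^ S * X) = y m - of_bool (L < 0)"
    using S y[OF assms(3)] four two
    by (intro signed_take_bit_add_multiple) (auto simp: of_bool_def)
  thus ?thesis
    unfolding P_def[symmetric] segment.simps drop below by simp
qed

section \<open>The product of the packed inputs as a digit sum\<close>

lemma finite_conv_index: "finite {(n, k). n < N \<and> k < K \<and> n + k = (m::nat)}"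
  by (rule finite_subset[of _ "{..<N} \<times> {..<K}"]) auto

text \<open>On the antidiagonal \<open>n + k = m\<close> each index determines the other, so both
  projections are injective.\<close>

lemma card_conv_index: "card {(n, k). n < N \<and> k < K \<and> n + k = (m::nat)} \<le> min K N"
proof -
  let ?I = "{(n, k). n < N \<and> k < K \<and> n + k = m}"
  have "card ?I \<le> card {..<N}"
    by (rule card_inj_on_le[of fst]) (auto simp: inj_on_def)
  moreover have "card ?I \<le> card {..<K}"
    by (rule card_inj_on_le[of snd]) (auto simp: inj_on_def)
  ultimately show ?thesis by simp
qed

lemma pack_mult_pack:
  assumes "1 \<le> N" and "1 \<le> K"
  shows "pack S N f * pack S K g = (\<Sum>m\<le>N + K - 2. conv N K f g m * 2 ^ (S * m))"
proof -
  let ?A = "{..<N} \<times> {..<K}"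
  let ?h = "\<lambda>(n, k). f n * g k * 2 ^ (S * (n + k))"
  have "pack S N f * pack S K g = (\<Sum>x\<in>?A. ?h x)"
    by (simp add: pack_def sum_product sum.cartesian_product power_add algebra_simps case_prod_beta)
  \<comment> \<open>Group the pairs by antidiagonal; the largest index sum is
    \<open>(N - 1) + (K - 1)\<close>.\<close>
  also have "\<dots> = (\<Sum>m\<le>N + K - 2. \<Sum>x\<in>{x\<in>?A. fst x + snd x = m}. ?h x)"
    using assms by (intro sum.group[symmetric]) auto
  also have "\<dots> = (\<Sum>m\<le>N + K - 2. conv N K f g m * 2 ^ (S * m))"
  proof (intro sum.cong refl)
    fix m
    have "{x\<in>?A. fst x + snd x = m} = {(n, k). n < N \<and> k < K \<and> n + k = m}" by auto
    thus "(\<Sum>x\<in>{x\<in>?A. fst x + snd x = m}. ?h x) = conv N K f g m * 2 ^ (S * m)"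
      unfolding conv_def sum_distrib_right by (auto intro!: sum.cong)
  qed
  finally show ?thesis .
qed

section \<open>Size of the partial convolutions\<close>

lemma abs_conv_le:
  assumes "\<And>n k. n < N \<Longrightarrow> k < K \<Longrightarrow> \<bar>f n * g k\<bar> \<le> c" and "0 \<le> c"
  shows "\<bar>conv N K f g m\<bar> \<le> int (min K N) * c"
proof -
  let ?I = "{(n, k). n < N \<and> k < K \<and> n + k = m}"
  have "\<bar>conv N K f g m\<bar> \<le> (\<Sum>x\<in>?I. \<bar>case x of (n, k) \<Rightarrow> f n * g k\<bar>)"
    unfolding conv_def by (rule sum_abs)
  also have "\<dots> \<le> int (card ?I) * c"
    using assms(1) by (intro sum_bounded_above) auto
  also have "\<dots> \<le> int (min K N) * c"
    using card_conv_index assms(2) by (intro mult_right_mono) (auto simp del: of_nat_min)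
  finally show ?thesis .
qed

lemma le_guard_power:
  assumes "ceillog2 t \<le> Gb"
  shows "int t \<le> 2 ^ Gb"
proof -
  have "t \<le> 2 ^ Gb" using assms le_two_power_ceillog2[of t] power_increasing[of "ceillog2 t" Gb "2::nat"]
    by linarith
  thus ?thesis by (metis of_nat_le_iff of_nat_numeral of_nat_power)
qed

lemma conv_Unsigned_bounds:
  assumes "1 \<le> N" and "1 \<le> K"
    and f: "\<And>n. n < N \<Longrightarrow> is_bits Unsigned p (f n)"
    and g: "\<And>k. k < K \<Longrightarrow> is_bits Unsigned q (g k)"
    and "valid_slice Unsigned p q N K Gb S"
  shows "0 \<le> conv N K f g m \<and> conv N K f g m < 2 ^ S"
proof -
  obtain w where w: "holds_product Unsigned p q w" "w + Gb \<le> S"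
    and Gb: "int (min K N) \<le> 2 ^ Gb"
    using assms(5) le_guard_power unfolding valid_slice_def by blast
  have prod: "0 \<le> f n * g k \<and> f n * g k < 2 ^ w" if "n < N" "k < K" for n k
    using w(1) f[OF that(1)] g[OF that(2)] unfolding holds_product_def by simp
  have "0 \<le> conv N K f g m"
    unfolding conv_def using prod by (intro sum_nonneg) auto
  \<comment> \<open>Keeping the integer bound \<open>2 ^ w - 1\<close> makes the final bound strict
    even when \<open>min K N\<close> equals \<open>2 ^ Gb\<close>.\<close>
  moreover have "\<bar>conv N K f g m\<bar> \<le> int (min K N) * (2 ^ w - 1)"
    using prod by (intro abs_conv_le) (auto simp: abs_of_nonneg)
  moreover have "int (min K N) * (2 ^ w - 1) < int (min K N) * 2 ^ w"
    using assms(1,2) by simp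
  moreover have "int (min K N) * 2 ^ w \<le> 2 ^ Gb * 2 ^ w"
    using Gb by (intro mult_right_mono) auto
  moreover have "2 ^ Gb * 2 ^ w \<le> (2::int) ^ S"
    using w(2) by (simp flip: power_add)
  ultimately show ?thesis by linarith
qed

text \<open>The two most negative elements have the positive product \<open>2 ^ (p + q - 2)\<close>.
  Width \<open>p + q - 1\<close> would hold its negative but not the product itself, because the
  signed range is open above.\<close>

lemma holds_product_Twos_Complement_width:
  assumes "holds_product Twos_Complement p q w" and "1 \<le> p" and "1 \<le> q"
  shows "p + q \<le> w"
proof -
  have p: "(2::int) ^ p = 2 * 2 ^ (p - 1)" and q: "(2::int) ^ q = 2 * 2 ^ (q - 1)"
    using assms(2,3) by (simp_all flip: power_Suc)
  have "is_bits Twos_Complement w (- (2 ^ (p - 1)) * - (2 ^ (q - 1)))"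
    using assms(1)[unfolded holds_product_def, rule_format, of "- (2 ^ (p - 1))" "- (2 ^ (q - 1))"]
    by (simp add: p q)
  hence "2 * ((2::int) ^ (p - 1) * 2 ^ (q - 1)) < 2 ^ w" by simp
  hence "(2::int) ^ (p + q - 1) < 2 ^ w"
    using assms(2,3) by (simp flip: power_add power_Suc)
  hence "p + q - 1 < w" by (rule power_less_imp_less_exp[rotated]) simp
  thus ?thesis by simp
qed

lemma conv_Twos_Complement_bounds:
  assumes "1 \<le> p" and "1 \<le> q"
    and f: "\<And>n. n < N \<Longrightarrow> is_bits Twos_Complement p (f n)"
    and g: "\<And>k. k < K \<Longrightarrow> is_bits Twos_Complement q (g k)"
    and "valid_slice Twos_Complement p q N K Gb S"
  shows "2 \<le> S \<and> 4 * \<bar>conv N K f g m\<bar> \<le> 2 ^ S"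
proof -
  obtain w where w: "holds_product Twos_Complement p q w" "w + Gb \<le> S"
    and Gb: "int (min K N) \<le> 2 ^ Gb"
    using assms(5) le_guard_power unfolding valid_slice_def by blast
  have pq: "p + q + Gb \<le> S"
    using holds_product_Twos_Complement_width[OF w(1) assms(1,2)] w(2) by simp
  let ?c = "(2::int) ^ (p - 1) * 2 ^ (q - 1)"
  have p: "(2::int) ^ p = 2 * 2 ^ (p - 1)" and q: "(2::int) ^ q = 2 * 2 ^ (q - 1)"
    using assms(1,2) by (simp_all flip: power_Suc)
  have prod: "\<bar>f n * g k\<bar> \<le> ?c" if "n < N" "k < K" for n k
    unfolding abs_mult
  proof (rule mult_mono)
    show "\<bar>f n\<bar> \<le> 2 ^ (p - 1)" "\<bar>g k\<bar> \<le> 2 ^ (q - 1)"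
      using f[OF that(1)] g[OF that(2)] unfolding is_bits.simps p q by linarith+
  qed auto
  have "\<bar>conv N K f g m\<bar> \<le> int (min K N) * ?c"
    using prod by (intro abs_conv_le) auto
  also have "\<dots> \<le> 2 ^ Gb * ?c"
    using Gb by (intro mult_right_mono) auto
  \<comment> \<open>The 4 consists of the two factors 2 that turn \<open>?c\<close> into
    \<open>2 ^ p * 2 ^ q\<close>.\<close>
  finally have "4 * \<bar>conv N K f g m\<bar> \<le> 2 ^ p * 2 ^ q * 2 ^ Gb"
    unfolding p q by (simp add: algebra_simps)
  also have "\<dots> \<le> 2 ^ S" using pq by (simp flip: power_add)
  finally show ?thesis using pq assms(1,2) by simp
qed

theorem theorem1:
  fixes fmt :: number_format
    and f g :: "nat \<Rightarrow> int"
    and L_A L_B p q N K S Gb :: nat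
    and A B Prod :: int
  assumes "1 \<le> p" and "1 \<le> q" and "1 \<le> N" and "1 \<le> K"
    and "\<And>n. n < N \<Longrightarrow> is_bits fmt p (f n)"
    and "\<And>k. k < K \<Longrightarrow> is_bits fmt q (g k)"
    and "valid_slice fmt p q N K Gb S"
    and "max_fit L_A S p N" and "max_fit L_B S q K"
    and "A = pack S N f" and "B = pack S K g"
    and "is_bits fmt L_A A" and "is_bits fmt L_B B"
    and "Prod = A * B"
  shows "(\<forall>m \<le> N + K - 2. segment fmt S Prod m = conv N K f g m)
    \<and> Prod = (\<Sum>m \<le> N + K - 2. segment fmt S Prod m * 2 ^ (S * m))"
proof -
  have Prod: "Prod = (\<Sum>m\<le>N + K - 2. conv N K f g m * 2 ^ (S * m))"
    using assms(10,11,14) pack_mult_pack[OF assms(3,4)] by simp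
  have seg: "segment fmt S Prod m = conv N K f g m" if "m \<le> N + K - 2" for m
  proof (cases fmt)
    case Unsigned
    show ?thesis
      unfolding Prod Unsigned
      using conv_Unsigned_bounds[OF assms(3,4,5,6,7)[unfolded Unsigned]] that
      by (intro segment_Unsigned_digit_sum) auto
  next
    case Twos_Complement
    show ?thesis
      unfolding Prod Twos_Complement
      using conv_Twos_Complement_bounds[OF assms(1,2,5,6,7)[unfolded Twos_Complement]] that
      by (intro segment_Twos_Complement_digit_sum) auto
  qed
  have "Prod = (\<Sum>m\<le>N + K - 2. segment fmt S Prod m * 2 ^ (S * m))"
    by (subst Prod) (simp add: seg)
  with seg show ?thesis by blast
qed

end
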